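(* Let $G$ be a finite group such that $\frac{G}{Z(G)} \cong Sz(2)$, where $Sz(2) = \langle a, b : a^5 = b^4 = 1,\ b^{-1}ab = a^2 \rangle$. Then \[ E(\Gamma_G) = 38|Z(G)| - 12, \] \[ LE(\Gamma_G) = \begin{cases} \frac{732|Z(G)| - 228}{19} & \text{if } |Z(G)| \leq 4,\\ \frac{120|Z(G)|^2 + 122|Z(G)| - 38}{19} & \text{if } |Z(G)| > 4, \end{cases} \] and \[ LE^+(\Gamma_G) = \begin{cases} \frac{712|Z(G)| - 228}{19} & \text{if } |Z(G)| = 1,\\ \frac{120|Z(G)|^2 + 530|Z(G)| - 190}{19} & \text{if } |Z(G)| > 1. \end{cases} \]
   Context: For a finite non-abelian group $G$ with center $Z(G)$, the commuting graph $\Gamma_G$ is the simple undirected graph with vertex set $G \setminus Z(G)$ in which two distinct vertices $x, y$ are adjacent iff $xy = yx$. For a finite graph $\mathcal{G}$ with vertex set $v(\mathcal{G})$, edge set $e(\mathcal{G})$, adjacency matrix $A$ and (diagonal) degree matrix $D$, put $L = D - A$ and $Q = D + A$. With all sums over eigenvalues counted with multiplicity: the energy is $E(\mathcal{G}) = \sum |\lambda|$ over eigenvalues $\lambda$ of $A$; the Laplacian energy is $LE(\mathcal{G}) = \sum \left|\mu - \frac{2|e(\mathcal{G})|}{|v(\mathcal{G})|}\right|$ over eigenvalues $\mu$ of $L$; the signless Laplacian energy is $LE^+(\mathcal{G}) = \sum \left|\nu - \frac{2|e(\mathcal{G})|}{|v(\mathcal{G})|}\right|$ over eigenvalues $\nu$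 of $Q$. *)

theory Defs
  imports
    "HOL-Algebra.Coset"
    "Jordan_Normal_Form.Char_Poly"
begin

section \<open>Groups given by generators and relations\<close>

text \<open>
  A letter \<open>(g, True)\<close> stands for the generator \<open>g\<close> and \<open>(g, False)\<close> for its formal inverse.
  Every element of the type \<open>'g\<close> is a generator.  A pair \<open>(l, r)\<close> of words is the relation
  \<open>l = r\<close>.  The group is the set of all words modulo the least congruence that contains the
  relations and the free cancellations.
\<close>

type_synonym 'g word = "('g \<times> bool) list"

inductive word_eq :: "('g word \<times> 'g word) set \<Rightarrow> 'g word \<Rightarrow> 'g word \<Rightarrow> bool"
  for R :: "('g word \<times> 'g word) set" where
  refl: "word_eq R u u"
| sym: "word_eq R u v \<Longrightarrow> word_eq R v u"
| trans: "word_eq R u v \<Longrightarrow> word_eq R v w \<Longrightarrow> word_eq R u w"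
| cancel: "word_eq R (u @ [(g, s), (g, \<not> s)] @ v) (u @ v)"
| relation: "(l, r) \<in> R \<Longrightarrow> word_eq R (u @ l @ v) (u @ r @ v)"

definition word_class :: "('g word \<times> 'g word) set \<Rightarrow> 'g word \<Rightarrow> 'g word set" where
  "word_class R u = {v. word_eq R u v}"

definition presented_group :: "('g word \<times> 'g word) set \<Rightarrow> 'g word set monoid" where
  "presented_group R =
    \<lparr> carrier = range (word_class R),
      monoid.mult = (\<lambda>X Y. \<Union>u\<in>X. \<Union>v\<in>Y. word_class R (u @ v)),
      one = word_class R [] \<rparr>"

lemma word_eq_context:
  "word_eq R u v \<Longrightarrow> word_eq R (p @ u @ q) (p @ v @ q)"
proof (induction rule: word_eq.induct)
  case (cancel u g s v)
  show ?case using word_eq.cancel[of R "p @ u" g s "v @ q"] by simp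
next
  case (relation l r u v)
  then show ?case using word_eq.relation[of l r R "p @ u" "v @ q"] by simp
qed (blast intro: word_eq.intros)+

lemma word_eq_append:
  assumes "word_eq R u u'" and "word_eq R v v'"
  shows "word_eq R (u @ v) (u' @ v')"
  using word_eq_context[OF assms(1), of "[]" v] word_eq_context[OF assms(2), of u' "[]"]
  by (auto intro: word_eq.trans)

lemma word_class_eq_iff: "word_class R u = word_class R v \<longleftrightarrow> word_eq R u v"
  unfolding word_class_def by (blast intro: word_eq.intros)

lemma presented_group_carrier: "carrier (presented_group R) = range (word_class R)"
  by (simp add: presented_group_def)

lemma presented_group_one: "\<one>\<^bsub>presented_group R\<^esub> = word_class R []"
  by (simp add: presented_group_def)

lemma presented_group_mult:
  "word_class R u \<otimes>\<^bsub>presented_group R\<^esub> word_class R v = word_class R (u @ v)"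
proof -
  have "word_class R (u' @ v') = word_class R (u @ v)"
    if "u' \<in> word_class R u" "v' \<in> word_class R v" for u' v'
  proof -
    have "word_eq R u u'" "word_eq R v v'"
      using that by (simp_all add: word_class_def)
    then have "word_eq R (u @ v) (u' @ v')"
      by (rule word_eq_append)
    then show ?thesis
      unfolding word_class_eq_iff by (rule word_eq.sym)
  qed
  moreover have "u \<in> word_class R u" "v \<in> word_class R v"
    by (auto simp: word_class_def intro: word_eq.refl)
  ultimately have "(\<Union>u'\<in>word_class R u. \<Union>v'\<in>word_class R v. word_class R (u' @ v'))
      = word_class R (u @ v)"
    by blast
  then show ?thesis by (simp add: presented_group_def)
qed

lemma word_eq_inverse: "word_eq R (rev (map (apsnd Not) u) @ u) []"
proof (induction u)
  case Nil
  show ?case by (simp add: word_eq.refl)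
next
  case (Cons x u)
  obtain g s where x: "x = (g, s)" by (cases x)
  show ?case
    using word_eq.cancel[of R "rev (map (apsnd Not) u)" g "\<not> s" u] Cons.IH
    by (simp add: x) (blast intro: word_eq.trans)
qed

lemma group_presented_group: "group (presented_group R)"
proof (rule groupI)
  fix X assume "X \<in> carrier (presented_group R)"
  then obtain u where X: "X = word_class R u" by (auto simp: presented_group_carrier)
  show "\<one>\<^bsub>presented_group R\<^esub> \<otimes>\<^bsub>presented_group R\<^esub> X = X"
    using presented_group_mult[of R "[]" u] by (simp add: X presented_group_one)
  show "\<exists>Y\<in>carrier (presented_group R). Y \<otimes>\<^bsub>presented_group R\<^esub> X = \<one>\<^bsub>presented_group R\<^esub>"
  proof
    show "word_class R (rev (map (apsnd Not) u)) \<otimes>\<^bsub>presented_group R\<^esub> X = \<one>\<^bsub>presented_group R\<^esub>"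
      using word_eq_inverse[of R u]
      by (simp add: X presented_group_mult presented_group_one word_class_eq_iff)
  qed (simp add: presented_group_carrier)
next
  fix X Y assume "X \<in> carrier (presented_group R)" "Y \<in> carrier (presented_group R)"
  then obtain u v where "X = word_class R u" "Y = word_class R v"
    by (auto simp: presented_group_carrier)
  then show "X \<otimes>\<^bsub>presented_group R\<^esub> Y \<in> carrier (presented_group R)"
    by (simp add: presented_group_mult presented_group_carrier)
next
  fix X Y Z
  assume "X \<in> carrier (presented_group R)" "Y \<in> carrier (presented_group R)"
    "Z \<in> carrier (presented_group R)"
  then obtain u v w where "X = word_class R u" "Y = word_class R v" "Z = word_class R w"
    by (auto simp: presented_group_carrier)
  then show "X \<otimes>\<^bsub>presented_group R\<^esub> Y \<otimes>\<^bsub>presented_group R\<^esub> Z =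
      X \<otimes>\<^bsub>presented_group R\<^esub> (Y \<otimes>\<^bsub>presented_group R\<^esub> Z)"
    by (simp add: presented_group_mult)
qed (simp add: presented_group_carrier presented_group_one)

datatype sz2_gen = Gen_a | Gen_b

text \<open>\<open>a\<^sup>5 = 1\<close>, \<open>b\<^sup>4 = 1\<close> and \<open>b\<^sup>-\<^sup>1 a b = a\<^sup>2\<close>\<close>

definition Sz2 :: "sz2_gen word set monoid" where
  "Sz2 = presented_group
    {(replicate 5 (Gen_a, True), []),
     (replicate 4 (Gen_b, True), []),
     ([(Gen_b, False), (Gen_a, True), (Gen_b, True)], replicate 2 (Gen_a, True))}"


section \<open>Energies of finite simple graphs\<close>

text \<open>The edges are meant to be two-element sets of vertices.\<close>

record 'v simple_graph =
  vertices :: "'v set"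
  edges :: "'v set set"

definition vertex_degree :: "'v simple_graph \<Rightarrow> 'v \<Rightarrow> nat" where
  "vertex_degree \<G> v = card {e \<in> edges \<G>. v \<in> e}"

text \<open>
  The matrices of a graph are written down with respect to some enumeration of the (finitely
  many) vertices.  Another enumeration conjugates all three of them by a permutation matrix, so
  that the eigenvalues and their multiplicities do not depend on it.
\<close>

definition vertex_list :: "'v simple_graph \<Rightarrow> 'v list" where
  "vertex_list \<G> = (SOME vs. distinct vs \<and> set vs = vertices \<G>)"

definition adjacency_matrix :: "'v simple_graph \<Rightarrow> real mat" where
  "adjacency_matrix \<G> =
    (let vs = vertex_list \<G>; n = card (vertices \<G>)
     in mat n n (\<lambda>(i, j). if {vs ! i, vs ! j} \<in> edges \<G> then 1 else 0))"

definition degree_matrix :: "'v simple_graph \<Rightarrow> real mat" where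
  "degree_matrix \<G> =
    (let vs = vertex_list \<G>; n = card (vertices \<G>)
     in mat_diag n (\<lambda>i. real (vertex_degree \<G> (vs ! i))))"

definition laplacian_matrix :: "'v simple_graph \<Rightarrow> real mat" where
  "laplacian_matrix \<G> = degree_matrix \<G> - adjacency_matrix \<G>"

definition signless_laplacian_matrix :: "'v simple_graph \<Rightarrow> real mat" where
  "signless_laplacian_matrix \<G> = degree_matrix \<G> + adjacency_matrix \<G>"

text \<open>
  Only real eigenvalues are collected.  The matrices above are real symmetric, so these are all
  of the complex eigenvalues, with the correct (algebraic = geometric) multiplicities.
\<close>

definition eigenvalues_mset :: "real mat \<Rightarrow> real multiset" where
  "eigenvalues_mset A = proots (char_poly A)"

definition energy :: "'v simple_graph \<Rightarrow> real" where
  "energy \<G> = (\<Sum>x\<in>#eigenvalues_mset (adjacency_matrix \<G>). \<bar>x\<bar>)"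

definition laplacian_energy :: "'v simple_graph \<Rightarrow> real" where
  "laplacian_energy \<G> =
    (\<Sum>x\<in>#eigenvalues_mset (laplacian_matrix \<G>).
       \<bar>x - 2 * real (card (edges \<G>)) / real (card (vertices \<G>))\<bar>)"

definition signless_laplacian_energy :: "'v simple_graph \<Rightarrow> real" where
  "signless_laplacian_energy \<G> =
    (\<Sum>x\<in>#eigenvalues_mset (signless_laplacian_matrix \<G>).
       \<bar>x - 2 * real (card (edges \<G>)) / real (card (vertices \<G>))\<bar>)"


section \<open>The commuting graph of a group\<close>

definition center :: "('a, 'b) monoid_scheme \<Rightarrow> 'a set" where
  "center G = {z \<in> carrier G. \<forall>x\<in>carrier G. x \<otimes>\<^bsub>G\<^esub> z = z \<otimes>\<^bsub>G\<^esub> x}"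

definition commuting_graph :: "('a, 'b) monoid_scheme \<Rightarrow> 'a simple_graph" where
  "commuting_graph G =
    \<lparr> vertices = carrier G - center G,
      edges = {{x, y} | x y. x \<in> carrier G - center G \<and> y \<in> carrier G - center G \<and>
                             x \<noteq> y \<and> x \<otimes>\<^bsub>G\<^esub> y = y \<otimes>\<^bsub>G\<^esub> x} \<rparr>"

end

theory Submission
  imports Defs
begin

text \<open>
  \<open>Sz(2)\<close> is the affine group of the field with five elements.  Two nontrivial affine maps commute
  iff both are translations or both have the same fixed point, and each of these six classes
  consists of the nontrivial powers of a single map.  Elements of \<open>G\<close> over powers of one map are
  powers of one element up to central factors, so commuting can be tested in the quotient, and the
  commuting graph is a disjoint union of one clique with \<open>4|Z(G)|\<close> and five cliques with
  \<open>3|Z(G)|\<close> vertices.  The three matrices of such a graph have the form \<open>D + s J\<close> with \<open>D\<close> diagonal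
  and constant on each clique and \<open>J\<close> the indicator of lying in the same clique; their characteristic
  polynomials follow from \<open>det (1 - P Q) = det (1 - Q P)\<close> with \<open>P\<close> the vertex-clique incidence matrix.
\<close>

section \<open>Characteristic polynomials of cluster matrices\<close>

text \<open>The block matrices \<open>X\<close> and \<open>Y\<close> are chosen so that
  \<open>X * Y\<close> and \<open>Y * X\<close> are both block upper triangular with one identity
  block; the other diagonal blocks are \<open>1 - P Q\<close> and \<open>1 - Q P\<close>, and
  \<open>det\<close> does not see the order of the factors.\<close>

lemma det_one_minus_mult_commute:
  fixes P Q :: "'a :: idom mat"
  assumes P: "P \<in> carrier_mat n k" and Q: "Q \<in> carrier_mat k n"
  shows "det (1\<^sub>m n - P * Q) = det (1\<^sub>m k - Q * P)"
proof -
  define X where "X = four_block_mat (1\<^sub>m n) P Q (1\<^sub>m k)"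
  define Y where "Y = four_block_mat (1\<^sub>m n) (0\<^sub>m n k) (- Q) (1\<^sub>m k)"
  have X: "X \<in> carrier_mat (n + k) (n + k)" and Y: "Y \<in> carrier_mat (n + k) (n + k)"
    using assms by (auto simp: X_def Y_def)
  have XY: "X * Y = four_block_mat (1\<^sub>m n - P * Q) P (0\<^sub>m k n) (1\<^sub>m k)"
    unfolding X_def Y_def
    by (subst mult_four_block_mat[OF _ P Q _ _ _ uminus_carrier_mat[OF Q]])
      (use P Q in \<open>auto intro!: cong_four_block_mat simp: minus_add_uminus_mat\<close>)
  have YX: "Y * X = four_block_mat (1\<^sub>m n) P (0\<^sub>m k n) (1\<^sub>m k - Q * P)"
    unfolding X_def Y_def
    by (subst mult_four_block_mat[OF _ _ uminus_carrier_mat[OF Q] _ _ P Q])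
      (use P Q in \<open>auto intro!: cong_four_block_mat eq_matI\<close>)
  have PQ: "1\<^sub>m n - P * Q \<in> carrier_mat n n" and QP: "1\<^sub>m k - Q * P \<in> carrier_mat k k"
    using assms by auto
  have "det (1\<^sub>m n - P * Q) = det (X * Y)"
    unfolding XY by (subst det_four_block_mat_lower_left_zero[OF PQ P HOL.refl]) auto
  also have "\<dots> = det (Y * X)"
    using X Y by (simp add: det_mult mult.commute)
  also have "\<dots> = det (1\<^sub>m k - Q * P)"
    unfolding YX by (subst det_four_block_mat_lower_left_zero[OF _ P HOL.refl QP]) auto
  finally show ?thesis .
qed

lemma det_mat_diag: "det (mat_diag n f) = (\<Prod>i<n. f i :: 'a :: idom)"
  by (subst det_upper_triangular[of _ n])
    (auto simp: mat_diag_def upper_triangular_def prod_list_diag_prod atLeast0LessThan intro!: prod.cong)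

lemma prod_by_class:
  fixes f :: "nat \<Rightarrow> 'a :: comm_monoid_mult" and c :: "nat \<Rightarrow> nat"
  assumes "\<And>i. i < n \<Longrightarrow> c i < k"
  shows "(\<Prod>i<n. f (c i)) = (\<Prod>j<k. f j ^ card {i. i < n \<and> c i = j})"
proof -
  have "(\<Prod>i<n. f (c i)) = (\<Prod>j<k. \<Prod>i\<in>{i \<in> {..<n}. c i = j}. f (c i))"
    by (intro prod.group[symmetric]) (use assms in auto)
  also have "\<dots> = (\<Prod>j<k. f j ^ card {i. i < n \<and> c i = j})"
    by (intro prod.cong HOL.refl) simp
  finally show ?thesis .
qed

text \<open>Off the values of \<open>d\<close>, \<open>x - M\<close> factors as
  \<open>1 - P Q\<close> times a diagonal matrix, and swapping \<open>P\<close> and \<open>Q\<close>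
  leaves a diagonal \<open>k\<close> by \<open>k\<close> determinant. Positivity of
  \<open>N j\<close> keeps the truncated exponent \<open>N j - 1\<close> correct: an empty class
  would contribute a spurious linear factor.\<close>

lemma char_poly_cluster:
  fixes d :: "nat \<Rightarrow> real" and s :: real and c :: "nat \<Rightarrow> nat"
  assumes c: "\<And>i. i < n \<Longrightarrow> c i < k"
    and N: "\<And>j. j < k \<Longrightarrow> N j = card {i. i < n \<and> c i = j}"
    and pos: "\<And>j. j < k \<Longrightarrow> 0 < N j"
  defines "M \<equiv> mat n n (\<lambda>(i, j). (if i = j then d (c i) else 0) + (if c i = c j then s else 0))"
  shows "char_poly M = (\<Prod>j<k. [:- d j, 1:] ^ (N j - 1) * [:- (d j + s * N j), 1:])"
    (is "_ = ?R")
proof -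
  have M: "M \<in> carrier_mat n n" by (simp add: M_def)
  have eq: "poly (char_poly M) x = poly ?R x" if x: "x \<notin> d ` {..<k}" for x
  proof -
    have nz: "x - d j \<noteq> 0" if "j < k" for j using x that by auto
    define P where "P = mat n k (\<lambda>(i, a). if c i = a then 1 else 0 :: real)"
    \<comment> \<open>This is the transposed incidence matrix with row \<open>a\<close> scaled by
      \<open>s / (x - d a)\<close>, which absorbs the inverse of the diagonal part.\<close>
    define Q where "Q = mat k n (\<lambda>(a, j). if c j = a then s / (x - d a) else 0)"
    have P: "P \<in> carrier_mat n k" and Q: "Q \<in> carrier_mat k n" by (simp_all add: P_def Q_def)
    have PQ: "P * Q = mat n n (\<lambda>(i, j). if c i = c j then s / (x - d (c j)) else 0)"
    proof (rule eq_matI)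
      fix i j assume "i < dim_row (mat n n (\<lambda>(i, j). if c i = c j then s / (x - d (c j)) else 0))"
        "j < dim_col (mat n n (\<lambda>(i, j). if c i = c j then s / (x - d (c j)) else 0))"
      then have ij: "i < n" "j < n" by auto
      have "(P * Q) $$ (i, j)
          = (\<Sum>a<k. (if c i = a then 1 else 0) * (if c j = a then s / (x - d a) else 0))"
        using ij by (auto simp: P_def Q_def scalar_prod_def atLeast0LessThan intro!: sum.cong)
      also have "\<dots> = (\<Sum>a<k. if c j = a then (if c i = a then s / (x - d a) else 0) else 0)"
        by (intro sum.cong) auto
      also have "\<dots> = (if c i = c j then s / (x - d (c j)) else 0)"
        using c[OF ij(2)] by (subst sum.delta') auto
      finally show "(P * Q) $$ (i, j)
          = mat n n (\<lambda>(i, j). if c i = c j then s / (x - d (c j)) else 0) $$ (i, j)"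
        using ij by simp
    qed (simp_all add: P_def Q_def)
    \<comment> \<open>Distinct classes are disjoint, so off-diagonal entries vanish, and each of the
      \<open>N a\<close> members of class \<open>a\<close> contributes the same summand.\<close>
    have QP: "Q * P = mat_diag k (\<lambda>a. s * N a / (x - d a))"
    proof (rule eq_matI)
      fix a b assume "a < dim_row (mat_diag k (\<lambda>a. s * N a / (x - d a)))"
        "b < dim_col (mat_diag k (\<lambda>a. s * N a / (x - d a)))"
      then have ab: "a < k" "b < k" by (auto simp: mat_diag_def)
      have "(Q * P) $$ (a, b)
          = (\<Sum>i<n. (if c i = a then s / (x - d a) else 0) * (if c i = b then 1 else 0))"
        using ab by (auto simp: P_def Q_def scalar_prod_def atLeast0LessThan intro!: sum.cong)
      also have "\<dots> = (\<Sum>i \<in> {i. i < n \<and> c i = a}. if a = b then s / (x - d a) else 0)"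
        by (rule sum.mono_neutral_cong_right) auto
      also have "\<dots> = (if a = b then s * N a / (x - d a) else 0)"
        by (simp add: N ab)
      finally show "(Q * P) $$ (a, b) = mat_diag k (\<lambda>a. s * N a / (x - d a)) $$ (a, b)"
        using ab by (simp add: mat_diag_def)
    qed (simp_all add: P_def Q_def mat_diag_def)
    have "- char_matrix M x = (1\<^sub>m n - P * Q) * mat_diag n (\<lambda>i. x - d (c i))"
      by (subst mat_diag_mult_right[of _ n n])
        (use nz c in \<open>auto simp: PQ M_def char_matrix_def field_simps intro!: eq_matI\<close>)
    then have "poly (char_poly M) x
        = det (1\<^sub>m n - P * Q) * det (mat_diag n (\<lambda>i. x - d (c i)))"
      unfolding char_poly_matrix[OF M] by (subst det_mult[of _ n, symmetric]) (use P Q in auto)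
    also have "1\<^sub>m k - Q * P = mat_diag k (\<lambda>a. 1 - s * N a / (x - d a))"
      unfolding QP by (auto simp: mat_diag_def intro!: eq_matI)
    then have "det (1\<^sub>m n - P * Q) = (\<Prod>j<k. 1 - s * N j / (x - d j))"
      by (simp add: det_one_minus_mult_commute[OF P Q] det_mat_diag)
    also have "det (mat_diag n (\<lambda>i. x - d (c i))) = (\<Prod>j<k. (x - d j) ^ N j)"
      unfolding det_mat_diag using c by (subst prod_by_class[where k = k]) (auto simp: N intro!: prod.cong)
    also have "(\<Prod>j<k. 1 - s * N j / (x - d j)) * (\<Prod>j<k. (x - d j) ^ N j)
        = (\<Prod>j<k. (x - d j) ^ (N j - 1) * (x - (d j + s * N j)))"
      unfolding prod.distrib[symmetric]
    proof (rule prod.cong[OF HOL.refl])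
      fix j assume "j \<in> {..<k}"
      then have "x - d j \<noteq> 0" "0 < N j" using nz pos by auto
      \<comment> \<open>One of the \<open>N j\<close> factors \<open>x - d j\<close> clears the
        denominator; the remaining \<open>m = N j - 1\<close> stay.\<close>
      then obtain m where "N j = Suc m" by (cases "N j") auto
      then show "(1 - s * N j / (x - d j)) * (x - d j) ^ N j
          = (x - d j) ^ (N j - 1) * (x - (d j + s * N j))"
        using \<open>x - d j \<noteq> 0\<close> by (simp add: field_simps)
    qed
    also have "\<dots> = poly ?R x"
      unfolding poly_prod
      by (intro prod.cong) (simp_all add: algebra_simps del: mult_pCons_right mult_pCons_left)
    finally show ?thesis .
  qed
  show ?thesis
  \<comment> \<open>A nonzero difference would have finitely many roots, yet it vanishes on the
    complement of a finite set of reals.\<close>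
  proof (rule ccontr)
    assume "char_poly M \<noteq> ?R"
    then have "finite {x. poly (char_poly M - ?R) x = 0}"
      by (intro poly_roots_finite) simp
    moreover have "- (d ` {..<k}) \<subseteq> {x. poly (char_poly M - ?R) x = 0}"
      using eq by auto
    ultimately have "finite (- (d ` {..<k}))" by (rule finite_subset[rotated])
    then have "finite (UNIV :: real set)"
      by (metis finite_compl finite_imageI finite_lessThan)
    then show False by (simp add: infinite_UNIV_char_0)
  qed
qed

text \<open>Roots of a product are collected with added multiplicities, so a sum over the spectrum
  becomes a sum over classes.\<close>

lemma sum_proots_cluster:
  fixes f :: "real \<Rightarrow> real" and k :: nat
  shows "(\<Sum>x\<in>#proots (\<Prod>j<k. [:- d j, 1:] ^ m j * [:- e j, 1:]). f x)
    = (\<Sum>j<k. m j * f (d j) + f (e j))"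
proof -
  have repeat: "(\<Sum>x\<in>#repeat_mset l {#y#}. f x) = l * f y" for l y
    by (induction l) (auto simp: algebra_simps)
  show ?thesis
  proof (induction k)
    case (Suc k)
    have "(\<Prod>j<k. [:- d j, 1:] ^ m j * [:- e j, 1:]) \<noteq> 0"
      by (simp del: mult_pCons_right mult_pCons_left)
    then have "proots (\<Prod>j<Suc k. [:- d j, 1:] ^ m j * [:- e j, 1:])
        = proots (\<Prod>j<k. [:- d j, 1:] ^ m j * [:- e j, 1:]) + (repeat_mset (m k) {#d k#} + {#e k#})"
      by (simp add: proots_mult proots_power del: mult_pCons_right mult_pCons_left)
    then show ?case using Suc by (simp add: repeat del: mult_pCons_right mult_pCons_left)
  qed simp
qed

section \<open>Disjoint unions of cliques\<close>

text \<open>Separates graph theory from group theory: \<open>\<kappa>\<close> labels each vertex by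
  its clique, and the energies will depend on the clique sizes \<open>N\<close> alone.\<close>

locale clique_union =
  fixes \<G> :: "'v simple_graph" and \<kappa> :: "'v \<Rightarrow> nat" and k :: nat and N :: "nat \<Rightarrow> nat"
  assumes finite_vertices: "finite (vertices \<G>)"
    and class_less: "v \<in> vertices \<G> \<Longrightarrow> \<kappa> v < k"
    and card_class: "j < k \<Longrightarrow> card {v \<in> vertices \<G>. \<kappa> v = j} = N j"
    and class_nonempty: "j < k \<Longrightarrow> 0 < N j"
    and edges_eq: "edges \<G> = {{x, y} | x y. x \<in> vertices \<G> \<and> y \<in> vertices \<G> \<and> x \<noteq> y \<and> \<kappa> x = \<kappa> y}"
begin

lemma distinct_vertex_list: "distinct (vertex_list \<G>)"
  and set_vertex_list: "set (vertex_list \<G>) = vertices \<G>"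
proof -
  have "\<exists>vs. distinct vs \<and> set vs = vertices \<G>"
    using finite_distinct_list[OF finite_vertices] by blast
  from someI_ex[OF this] show "distinct (vertex_list \<G>)" "set (vertex_list \<G>) = vertices \<G>"
    unfolding vertex_list_def by blast+
qed

lemma length_vertex_list: "length (vertex_list \<G>) = card (vertices \<G>)"
  using distinct_card[OF distinct_vertex_list] by (simp add: set_vertex_list)

lemma nth_vertex_list: "i < card (vertices \<G>) \<Longrightarrow> vertex_list \<G> ! i \<in> vertices \<G>"
  using nth_mem[of i "vertex_list \<G>"] by (simp add: length_vertex_list set_vertex_list)

lemma edge_iff:
  "{x, y} \<in> edges \<G> \<longleftrightarrow> x \<in> vertices \<G> \<and> y \<in> vertices \<G> \<and> x \<noteq> y \<and> \<kappa> x = \<kappa> y"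
  by (auto simp: edges_eq doubleton_eq_iff)

lemma vertex_degree_eq:
  assumes v: "v \<in> vertices \<G>"
  shows "vertex_degree \<G> v = N (\<kappa> v) - 1"
proof -
  let ?C = "{x \<in> vertices \<G>. \<kappa> x = \<kappa> v}"
  \<comment> \<open>Edges at \<open>v\<close> correspond to the other members of its clique.\<close>
  have "{e \<in> edges \<G>. v \<in> e} = (\<lambda>y. {v, y}) ` (?C - {v})"
    using v by (auto simp: edges_eq)
  moreover have "inj_on (\<lambda>y. {v, y}) (?C - {v})"
    by (auto simp: inj_on_def doubleton_eq_iff)
  ultimately have "vertex_degree \<G> v = card (?C - {v})"
    by (simp add: vertex_degree_def card_image)
  also have "\<dots> = N (\<kappa> v) - 1"
    using v finite_vertices by (simp add: card_class class_less)
  finally show ?thesis .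
qed

lemma card_vertices: "card (vertices \<G>) = (\<Sum>j<k. N j)"
proof -
  have "card (vertices \<G>) = (\<Sum>j<k. \<Sum>v\<in>{v \<in> vertices \<G>. \<kappa> v = j}. 1)"
    using finite_vertices class_less by (subst sum.group) auto
  then show ?thesis by (simp add: card_class)
qed

text \<open>Edges are exactly the two-element subsets of the classes. The count is doubled because
  only twice the edge number enters the mean degree.\<close>

lemma card_edges: "2 * real (card (edges \<G>)) = (\<Sum>j<k. N j * (real (N j) - 1))"
proof -
  let ?V = "\<lambda>j. {v \<in> vertices \<G>. \<kappa> v = j}"
  have "edges \<G> = (\<Union>j<k. {e. e \<subseteq> ?V j \<and> card e = 2})"
    unfolding edges_eq by (fastforce simp: card_2_iff class_less)
  moreover have "disjoint_family_on (\<lambda>j. {e. e \<subseteq> ?V j \<and> card e = 2}) {..<k}"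
    unfolding disjoint_family_on_def by (fastforce simp: card_2_iff)
  ultimately have "card (edges \<G>) = (\<Sum>j<k. card {e. e \<subseteq> ?V j \<and> card e = 2})"
    using finite_vertices by (simp add: card_UN_disjoint disjoint_family_on_def)
  also have "\<dots> = (\<Sum>j<k. N j choose 2)"
    using finite_vertices by (simp add: n_subsets card_class)
  also have "2 * real \<dots> = (\<Sum>j<k. real (2 * (N j choose 2)))"
    by (simp add: sum_distrib_left)
  also have "\<dots> = (\<Sum>j<k. N j * (real (N j) - 1))"
  proof (rule sum.cong[OF HOL.refl])
    fix j assume "j \<in> {..<k}"
    then have "0 < N j" using class_nonempty by simp
    then show "real (2 * (N j choose 2)) = N j * (real (N j) - 1)"
      by (cases "N j") (simp_all add: choose_two algebra_simps del: of_nat_mult flip: of_nat_mult)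
  qed
  finally show ?thesis .
qed

section \<open>Spectra and energies of a disjoint union of cliques\<close>

lemma class_size_vertex_list:
  assumes "j < k"
  shows "N j = card {i. i < card (vertices \<G>) \<and> \<kappa> (vertex_list \<G> ! i) = j}"
proof -
  let ?I = "{i. i < card (vertices \<G>) \<and> \<kappa> (vertex_list \<G> ! i) = j}"
  have "(\<lambda>i. vertex_list \<G> ! i) ` ?I = {v \<in> vertices \<G>. \<kappa> v = j}"
    by (auto simp: nth_vertex_list image_iff)
      (metis in_set_conv_nth length_vertex_list set_vertex_list)
  moreover have "inj_on (\<lambda>i. vertex_list \<G> ! i) ?I"
    by (auto simp: inj_on_def nth_eq_iff_index_eq[OF distinct_vertex_list] length_vertex_list)
  ultimately show ?thesis
    using card_image[of "\<lambda>i. vertex_list \<G> ! i" ?I] assms by (simp add: card_class)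
qed

text \<open>Class \<open>j\<close> contributes the eigenvalue \<open>d j\<close> with multiplicity
  \<open>N j - 1\<close> (vectors on the clique with sum zero) and \<open>d j + s * N j\<close> once
  (the constant vector). Leaving \<open>f\<close> arbitrary serves all three energies.\<close>

lemma sum_eigenvalues:
  fixes d :: "nat \<Rightarrow> real" and f :: "real \<Rightarrow> real"
  assumes A: "A \<in> carrier_mat (card (vertices \<G>)) (card (vertices \<G>))"
    and entries: "\<And>i j. i < card (vertices \<G>) \<Longrightarrow> j < card (vertices \<G>) \<Longrightarrow>
      A $$ (i, j) = (if i = j then d (\<kappa> (vertex_list \<G> ! i)) else 0)
        + (if \<kappa> (vertex_list \<G> ! i) = \<kappa> (vertex_list \<G> ! j) then s else 0)"
  shows "(\<Sum>x\<in>#eigenvalues_mset A. f x) = (\<Sum>j<k. (real (N j) - 1) * f (d j) + f (d j + s * N j))"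
proof -
  let ?n = "card (vertices \<G>)" and ?c = "\<lambda>i. \<kappa> (vertex_list \<G> ! i)"
  have "A = mat ?n ?n (\<lambda>(i, j). (if i = j then d (?c i) else 0) + (if ?c i = ?c j then s else 0))"
    using A by (auto simp: entries intro!: eq_matI)
  moreover have "?c i < k" if "i < ?n" for i
    using that by (simp add: class_less nth_vertex_list)
  ultimately have "char_poly A = (\<Prod>j<k. [:- d j, 1:] ^ (N j - 1) * [:- (d j + s * N j), 1:])"
    using char_poly_cluster[of ?n ?c k N d s] class_size_vertex_list class_nonempty by simp
  then have "(\<Sum>x\<in>#eigenvalues_mset A. f x) = (\<Sum>j<k. (N j - 1) * f (d j) + f (d j + s * N j))"
    unfolding eigenvalues_mset_def by (simp only: sum_proots_cluster)
  also have "\<dots> = (\<Sum>j<k. (real (N j) - 1) * f (d j) + f (d j + s * N j))"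
    using class_nonempty by (intro sum.cong) (auto simp: of_nat_diff Suc_leI)
  finally show ?thesis .
qed

lemma adjacency_matrix_carrier:
  "adjacency_matrix \<G> \<in> carrier_mat (card (vertices \<G>)) (card (vertices \<G>))"
  by (simp add: adjacency_matrix_def Let_def)

lemma degree_matrix_carrier:
  "degree_matrix \<G> \<in> carrier_mat (card (vertices \<G>)) (card (vertices \<G>))"
  by (simp add: degree_matrix_def Let_def)

lemma adjacency_matrix_entry:
  assumes "i < card (vertices \<G>)" "j < card (vertices \<G>)"
  shows "adjacency_matrix \<G> $$ (i, j) = (if i = j then - 1 else 0)
    + (if \<kappa> (vertex_list \<G> ! i) = \<kappa> (vertex_list \<G> ! j) then 1 else 0)"
  using assms nth_eq_iff_index_eq[OF distinct_vertex_list, of i j]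
  by (simp add: adjacency_matrix_def Let_def edge_iff nth_vertex_list length_vertex_list)

lemma degree_matrix_entry:
  assumes "i < card (vertices \<G>)" "j < card (vertices \<G>)"
  shows "degree_matrix \<G> $$ (i, j) = (if i = j then real (N (\<kappa> (vertex_list \<G> ! i))) - 1 else 0)"
  using assms class_nonempty[OF class_less[OF nth_vertex_list[OF assms(1)]]]
  by (auto simp add: of_nat_diff Suc_leI degree_matrix_def Let_def mat_diag_def vertex_degree_eq nth_vertex_list)

text \<open>Here \<open>d\<close> is constantly \<open>-1\<close> and \<open>s = 1\<close>: each
  clique has the eigenvalues \<open>-1\<close> and \<open>N j - 1\<close>.\<close>

lemma energy_eq: "energy \<G> = (\<Sum>j<k. 2 * (real (N j) - 1))"
proof -
  have "energy \<G> = (\<Sum>j<k. (real (N j) - 1) * \<bar>- 1\<bar> + \<bar>- 1 + 1 * real (N j)\<bar>)"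
    unfolding energy_def
    by (rule sum_eigenvalues[OF adjacency_matrix_carrier]) (simp add: adjacency_matrix_entry)
  also have "\<dots> = (\<Sum>j<k. 2 * (real (N j) - 1))"
    using class_nonempty by (intro sum.cong) (auto simp: Suc_leI abs_if)
  finally show ?thesis .
qed

abbreviation "mean_degree \<equiv> 2 * real (card (edges \<G>)) / real (card (vertices \<G>))"

text \<open>Here \<open>d j = N j\<close> and \<open>s = -1\<close>, so the simple eigenvalue of
  each clique is 0 and leaves the summand \<open>\<bar>mean_degree\<bar>\<close>.\<close>

lemma laplacian_energy_eq:
  "laplacian_energy \<G> = (\<Sum>j<k. (real (N j) - 1) * \<bar>N j - mean_degree\<bar> + \<bar>mean_degree\<bar>)"
proof -
  have "laplacian_energy \<G> = (\<Sum>j<k. (real (N j) - 1) * \<bar>real (N j) - mean_degree\<bar>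
      + \<bar>real (N j) + - 1 * real (N j) - mean_degree\<bar>)"
    unfolding laplacian_energy_def
    by (rule sum_eigenvalues[where f = "\<lambda>x. \<bar>x - mean_degree\<bar>"])
      (use adjacency_matrix_carrier degree_matrix_carrier in
        \<open>auto simp: laplacian_matrix_def adjacency_matrix_entry degree_matrix_entry split: if_splits\<close>)
  then show ?thesis by simp
qed

text \<open>Here \<open>d j = N j - 2\<close> and \<open>s = 1\<close>, so the simple eigenvalue is
  \<open>2 * N j - 2\<close>.\<close>

lemma signless_laplacian_energy_eq:
  "signless_laplacian_energy \<G> =
    (\<Sum>j<k. (real (N j) - 1) * \<bar>real (N j) - 2 - mean_degree\<bar> + \<bar>2 * real (N j) - 2 - mean_degree\<bar>)"
proof -
  have "signless_laplacian_energy \<G> = (\<Sum>j<k. (real (N j) - 1) * \<bar>real (N j) - 2 - mean_degree\<bar>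
      + \<bar>real (N j) - 2 + 1 * real (N j) - mean_degree\<bar>)"
    unfolding signless_laplacian_energy_def
    by (rule sum_eigenvalues[where f = "\<lambda>x. \<bar>x - mean_degree\<bar>"])
      (use adjacency_matrix_carrier degree_matrix_carrier in
        \<open>auto simp: signless_laplacian_matrix_def adjacency_matrix_entry degree_matrix_entry split: if_splits\<close>)
  then show ?thesis by (simp add: algebra_simps)
qed

end

section \<open>\<open>Sz(2)\<close> as an affine group\<close>

text \<open>The pair \<open>(u, v)\<close> is the map \<open>x \<mapsto> u x + v\<close> modulo 5; maps act from the right.\<close>

definition aff5 :: "(nat \<times> nat) monoid" where
  "aff5 = \<lparr> carrier = {1..<5} \<times> {..<5},
     monoid.mult = (\<lambda>p q. (fst p * fst q mod 5, (snd p * fst q + snd q) mod 5)),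
     one = (1, 0) \<rparr>"

text \<open>
  The class of a non-translation is its fixed point \<open>v / (1 - u)\<close>, where \<open>6 - u\<close> represents \<open>1 - u\<close>
  and its cube is its inverse modulo 5; translations get the extra class 5.
\<close>

definition aff5_class :: "nat \<times> nat \<Rightarrow> nat" where
  "aff5_class p = (if fst p = 1 then 5 else snd p * (6 - fst p) ^ 3 mod 5)"

text \<open>A generator of the centralizer: \<open>x \<mapsto> x + 1\<close>, or \<open>x \<mapsto> 2 x - t\<close> with fixed point \<open>t\<close>.\<close>

definition aff5_root :: "nat \<Rightarrow> nat \<times> nat" where
  "aff5_root t = (if t = 5 then (1, 1) else (2, 4 * t mod 5))"

text \<open>The list form makes bounded quantifiers over the 20 elements executable.\<close>

lemma aff5_carrier: "carrier aff5 = set (List.product [1..<5] [0..<5])"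
  by (auto simp: aff5_def)

lemma group_aff5: "group aff5"
proof (rule groupI)
  have "\<forall>p\<in>carrier aff5. \<forall>q\<in>carrier aff5. p \<otimes>\<^bsub>aff5\<^esub> q \<in> carrier aff5"
    unfolding aff5_carrier by code_simp
  then show "p \<otimes>\<^bsub>aff5\<^esub> q \<in> carrier aff5" if "p \<in> carrier aff5" "q \<in> carrier aff5" for p q
    using that by blast
  have "\<forall>p\<in>carrier aff5. \<exists>q\<in>carrier aff5. q \<otimes>\<^bsub>aff5\<^esub> p = \<one>\<^bsub>aff5\<^esub>"
    unfolding aff5_carrier by code_simp
  then show "\<exists>q\<in>carrier aff5. q \<otimes>\<^bsub>aff5\<^esub> p = \<one>\<^bsub>aff5\<^esub>" if "p \<in> carrier aff5" for p
    using that by blast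
next
  \<comment> \<open>Associativity is proved by modular arithmetic instead of evaluating 8000
    triples.\<close>
  fix p q r :: "nat \<times> nat"
  have "((snd p * fst q + snd q) mod 5 * fst r + snd r) mod 5
      = (snd p * (fst q * fst r mod 5) + (snd q * fst r + snd r) mod 5) mod 5"
  proof -
    have l: "(A mod 5 * B + C) mod 5 = (A * B + C) mod 5" for A B C :: nat
      by (metis mod_add_left_eq mod_mult_left_eq)
    have "(A * (B mod 5) + C) mod 5 = (A * B + C) mod 5" for A B C :: nat
      by (metis mod_add_left_eq mod_mult_right_eq)
    then have r: "(A * (B mod 5) + C mod 5) mod 5 = (A * B + C) mod 5" for A B C :: nat
      by (simp only: mod_add_right_eq)
    show ?thesis unfolding l r by (simp only: algebra_simps)
  qed
  then show "p \<otimes>\<^bsub>aff5\<^esub> q \<otimes>\<^bsub>aff5\<^esub> r = p \<otimes>\<^bsub>aff5\<^esub> (q \<otimes>\<^bsub>aff5\<^esub> r)"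
    by (simp add: aff5_def mod_mult_left_eq mod_mult_right_eq mult.assoc)
qed (auto simp: aff5_def)

text \<open>This direction passes from \<open>G\<close> to the quotient. Commuting in a quotient
  does not lift in general, so the converse goes through common roots.\<close>

lemma aff5_commute_imp_class_eq:
  assumes "p \<in> carrier aff5 - {\<one>\<^bsub>aff5\<^esub>}" "q \<in> carrier aff5 - {\<one>\<^bsub>aff5\<^esub>}"
    and "p \<otimes>\<^bsub>aff5\<^esub> q = q \<otimes>\<^bsub>aff5\<^esub> p"
  shows "aff5_class p = aff5_class q"
proof -
  have "\<forall>p\<in>carrier aff5. \<forall>q\<in>carrier aff5. p \<noteq> \<one>\<^bsub>aff5\<^esub> \<longrightarrow> q \<noteq> \<one>\<^bsub>aff5\<^esub> \<longrightarrow>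
      p \<otimes>\<^bsub>aff5\<^esub> q = q \<otimes>\<^bsub>aff5\<^esub> p \<longrightarrow> aff5_class p = aff5_class q"
    unfolding aff5_carrier by code_simp
  with assms show ?thesis by blast
qed

lemma aff5_root_closed: "aff5_root t \<in> carrier aff5"
  by (auto simp: aff5_def aff5_root_def)

lemma aff5_power_of_root:
  assumes "p \<in> carrier aff5 - {\<one>\<^bsub>aff5\<^esub>}"
  shows "\<exists>k::nat. p = aff5_root (aff5_class p) [^]\<^bsub>aff5\<^esub> k"
proof -
  \<comment> \<open>The roots have order 4 or 5, so exponents below 5 suffice; iterated
    multiplication replaces the group power to stay executable.\<close>
  have "\<forall>p\<in>carrier aff5. p \<noteq> \<one>\<^bsub>aff5\<^esub> \<longrightarrow>
      (\<exists>k\<in>set [0..<5]. p = ((\<lambda>r. r \<otimes>\<^bsub>aff5\<^esub> aff5_root (aff5_class p)) ^^ k) \<one>\<^bsub>aff5\<^esub>)"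
    unfolding aff5_carrier by code_simp
  moreover have "((\<lambda>r. r \<otimes>\<^bsub>aff5\<^esub> q) ^^ k) \<one>\<^bsub>aff5\<^esub> = q [^]\<^bsub>aff5\<^esub> k" for q k
    by (induction k) auto
  ultimately show ?thesis using assms by fastforce
qed

text \<open>There are four nontrivial translations, and each fixed point belongs to one map for each
  of the slopes 2, 3 and 4.\<close>

lemma card_aff5_class:
  assumes "t < 6"
  shows "card {p \<in> carrier aff5 - {\<one>\<^bsub>aff5\<^esub>}. aff5_class p = t} = (if t = 5 then 4 else 3)"
proof -
  have "\<forall>t\<in>set [0..<6]. card (Set.filter (\<lambda>p. aff5_class p = t) (carrier aff5 - {\<one>\<^bsub>aff5\<^esub>}))
      = (if t = 5 then 4 else 3)"
    unfolding aff5_carrier by code_simp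
  with assms show ?thesis by simp
qed

lemma aff5_class_less: "aff5_class p < 6"
  by (simp add: aff5_class_def less_Suc_eq_le[of _ 5, simplified] order_less_imp_le)

section \<open>The isomorphism between the presented group and the affine group\<close>

fun aff5_letter :: "sz2_gen \<times> bool \<Rightarrow> nat \<times> nat" where
  "aff5_letter (Gen_a, True) = (1, 1)"
| "aff5_letter (Gen_a, False) = (1, 4)"
| "aff5_letter (Gen_b, True) = (2, 0)"
| "aff5_letter (Gen_b, False) = (3, 0)"

definition aff5_word :: "sz2_gen word \<Rightarrow> nat \<times> nat" where
  "aff5_word w = foldr (\<lambda>x p. aff5_letter x \<otimes>\<^bsub>aff5\<^esub> p) w \<one>\<^bsub>aff5\<^esub>"

interpretation aff5: group aff5 by (rule group_aff5)

lemma aff5_letter_closed: "aff5_letter x \<in> carrier aff5"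
  by (cases x rule: aff5_letter.cases) (auto simp: aff5_def)

lemma aff5_word_closed: "aff5_word w \<in> carrier aff5"
  by (induction w) (auto simp: aff5_word_def aff5_letter_closed)

lemma aff5_word_append: "aff5_word (u @ v) = aff5_word u \<otimes>\<^bsub>aff5\<^esub> aff5_word v"
proof (induction u)
  case Nil
  then show ?case using aff5_word_closed[of v] by (simp add: aff5_word_def)
next
  case (Cons x u)
  have "aff5_word (y # w) = aff5_letter y \<otimes>\<^bsub>aff5\<^esub> aff5_word w" for y w
    by (simp add: aff5_word_def)
  with Cons show ?case by (simp add: aff5.m_assoc aff5_letter_closed aff5_word_closed)
qed

abbreviation Sz2_relations where
  "Sz2_relations \<equiv>
    {(replicate 5 (Gen_a, True), []),
     (replicate 4 (Gen_b, True), []),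
     ([(Gen_b, False), (Gen_a, True), (Gen_b, True)], replicate 2 (Gen_a, True))}"

text \<open>The defining relations hold in \<open>aff5\<close>, so evaluation of words is constant
  on congruence classes.\<close>

lemma word_eq_imp_aff5_word_eq:
  "word_eq Sz2_relations u v \<Longrightarrow> aff5_word u = aff5_word v"
proof (induction rule: word_eq.induct)
  case (cancel u g s v)
  have "aff5_word [(g, s), (g, \<not> s)] = \<one>\<^bsub>aff5\<^esub>"
    by (cases g; cases s) (auto simp: aff5_word_def aff5_def)
  then show ?case unfolding aff5_word_append by (simp add: aff5_word_closed)
next
  case (relation l r u v)
  \<comment> \<open>With maps acting from the right, the third left-hand side is
    \<open>x \<mapsto> 2 (3 x + 1) = x + 2\<close> modulo 5, the square of
    \<open>x \<mapsto> x + 1\<close>.\<close>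
  have "aff5_word (replicate 5 (Gen_a, True)) = aff5_word []"
    and "aff5_word (replicate 4 (Gen_b, True)) = aff5_word []"
    and "aff5_word [(Gen_b, False), (Gen_a, True), (Gen_b, True)] = aff5_word (replicate 2 (Gen_a, True))"
    by code_simp+
  with relation have "aff5_word l = aff5_word r" by blast
  then show ?case unfolding aff5_word_append by simp
qed auto

definition aff5_of_Sz2 :: "sz2_gen word set \<Rightarrow> nat \<times> nat" where
  "aff5_of_Sz2 X = aff5_word (SOME w. w \<in> X)"

lemma aff5_of_Sz2_word_class: "aff5_of_Sz2 (word_class Sz2_relations w) = aff5_word w"
proof -
  have "w \<in> word_class Sz2_relations w" by (simp add: word_class_def word_eq.refl)
  then have "(SOME v. v \<in> word_class Sz2_relations w) \<in> word_class Sz2_relations w"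
    by (rule someI)
  then show ?thesis
    unfolding aff5_of_Sz2_def by (simp add: word_class_def word_eq_imp_aff5_word_eq)
qed

lemma group_Sz2: "group Sz2"
  unfolding Sz2_def by (rule group_presented_group)

lemma Sz2_carrier: "carrier Sz2 = range (word_class Sz2_relations)"
  by (simp add: Sz2_def presented_group_carrier)

lemma Sz2_mult: "word_class Sz2_relations u \<otimes>\<^bsub>Sz2\<^esub> word_class Sz2_relations v
    = word_class Sz2_relations (u @ v)"
  by (simp add: Sz2_def presented_group_mult)

lemma Sz2_one: "\<one>\<^bsub>Sz2\<^esub> = word_class Sz2_relations []"
  by (simp add: Sz2_def presented_group_one)

lemma aff5_of_Sz2_hom: "aff5_of_Sz2 \<in> hom Sz2 aff5"
  by (rule homI)
    (auto simp: Sz2_carrier Sz2_mult aff5_of_Sz2_word_class aff5_word_append aff5_word_closed)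

text \<open>The relation \<open>a b = b a a\<close> moves every \<open>b\<close> to the left, and
  the orders bound the exponents. This gives at most 20 elements.\<close>

lemma Sz2_normal_form:
  assumes "X \<in> carrier Sz2"
  defines "a \<equiv> word_class Sz2_relations [(Gen_a, True)]"
    and "b \<equiv> word_class Sz2_relations [(Gen_b, True)]"
  shows "\<exists>i<4. \<exists>j<5. X = b [^]\<^bsub>Sz2\<^esub> (i::nat) \<otimes>\<^bsub>Sz2\<^esub> a [^]\<^bsub>Sz2\<^esub> (j::nat)"
proof -
  interpret S: group Sz2 by (rule group_Sz2)
  let ?C = "word_class Sz2_relations"
  have a: "a \<in> carrier Sz2" and b: "b \<in> carrier Sz2"
    by (auto simp: a_def b_def Sz2_carrier)
  have pow: "?C [x] [^]\<^bsub>Sz2\<^esub> m = ?C (replicate m x)" for x m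
    by (induction m) (auto simp: Sz2_one Sz2_mult replicate_append_same)
  have rel: "?C l = ?C r" if "(l, r) \<in> Sz2_relations" for l r
    using word_eq.relation[OF that, of "[]" "[]"] by (simp add: word_class_eq_iff)
  have a5: "a [^]\<^bsub>Sz2\<^esub> (5::nat) = \<one>\<^bsub>Sz2\<^esub>" and b4: "b [^]\<^bsub>Sz2\<^esub> (4::nat) = \<one>\<^bsub>Sz2\<^esub>"
    unfolding a_def b_def pow Sz2_one by (rule rel; simp)+
  have ab: "a \<otimes>\<^bsub>Sz2\<^esub> b = b \<otimes>\<^bsub>Sz2\<^esub> (a \<otimes>\<^bsub>Sz2\<^esub> a)"
  proof -
    have "?C ([(Gen_b, False)] @ [(Gen_a, True), (Gen_b, True)]) = ?C [(Gen_a, True), (Gen_a, True)]"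
      using rel[of "[(Gen_b, False), (Gen_a, True), (Gen_b, True)]" "replicate 2 (Gen_a, True)"]
      by (simp add: numeral_2_eq_2)
    then have "?C ([(Gen_b, True)] @ [(Gen_a, True), (Gen_a, True)])
        = ?C ([(Gen_b, True)] @ [(Gen_b, False)] @ [(Gen_a, True), (Gen_b, True)])"
      unfolding Sz2_mult[symmetric] by simp
    also have "\<dots> = ?C [(Gen_a, True), (Gen_b, True)]"
      using word_eq.cancel[of Sz2_relations "[]" Gen_b True "[(Gen_a, True), (Gen_b, True)]"]
      by (simp add: word_class_eq_iff)
    finally show ?thesis by (simp add: a_def b_def Sz2_mult)
  qed
  \<comment> \<open>Finite order turns the inverse of a generator into a nonnegative power, so
    formal inverses can be eliminated.\<close>
  have inv: "?C [(g, False)] = ?C [(g, True)] [^]\<^bsub>Sz2\<^esub> m"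
    if "?C [(g, True)] [^]\<^bsub>Sz2\<^esub> Suc m = \<one>\<^bsub>Sz2\<^esub>" for g m
  proof -
    have C: "?C [(g, s)] \<in> carrier Sz2" for s by (simp add: Sz2_carrier)
    have l: "?C [(g, True)] [^]\<^bsub>Sz2\<^esub> m \<otimes>\<^bsub>Sz2\<^esub> ?C [(g, True)] = \<one>\<^bsub>Sz2\<^esub>" using that by simp
    have r: "?C [(g, True)] \<otimes>\<^bsub>Sz2\<^esub> ?C [(g, False)] = \<one>\<^bsub>Sz2\<^esub>"
      using word_eq.cancel[of Sz2_relations "[]" g True "[]"]
      by (simp add: Sz2_mult Sz2_one word_class_eq_iff)
    show ?thesis
      by (rule S.inv_unique[OF l r C S.nat_pow_closed[OF C] C, symmetric])
  qed
  have ab_pow: "a [^]\<^bsub>Sz2\<^esub> j \<otimes>\<^bsub>Sz2\<^esub> b = b \<otimes>\<^bsub>Sz2\<^esub> a [^]\<^bsub>Sz2\<^esub> (2 * j)" for j :: nat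
  proof (induction j)
    case 0
    then show ?case using b by simp
  next
    case (Suc j)
    have "a [^]\<^bsub>Sz2\<^esub> Suc j \<otimes>\<^bsub>Sz2\<^esub> b = a [^]\<^bsub>Sz2\<^esub> j \<otimes>\<^bsub>Sz2\<^esub> (a \<otimes>\<^bsub>Sz2\<^esub> b)"
      using a b by (simp add: S.m_assoc)
    also have "\<dots> = a [^]\<^bsub>Sz2\<^esub> j \<otimes>\<^bsub>Sz2\<^esub> b \<otimes>\<^bsub>Sz2\<^esub> (a \<otimes>\<^bsub>Sz2\<^esub> a)"
      unfolding ab using a b by (simp add: S.m_assoc)
    also have "\<dots> = b \<otimes>\<^bsub>Sz2\<^esub> (a [^]\<^bsub>Sz2\<^esub> (2 * j) \<otimes>\<^bsub>Sz2\<^esub> a \<otimes>\<^bsub>Sz2\<^esub> a)"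
      unfolding Suc using a b by (simp add: S.m_assoc)
    finally show ?case by simp
  qed
  \<comment> \<open>Normal form with unbounded exponents. It is stable under right multiplication by
    powers of \<open>a\<close> and \<open>b\<close>, which drives an induction appending letters at
    the end of a word.\<close>
  define Good where "Good X \<longleftrightarrow> (\<exists>(i::nat) (j::nat). X = b [^]\<^bsub>Sz2\<^esub> i \<otimes>\<^bsub>Sz2\<^esub> a [^]\<^bsub>Sz2\<^esub> j)" for X
  have Good_a: "Good (X \<otimes>\<^bsub>Sz2\<^esub> a [^]\<^bsub>Sz2\<^esub> (m::nat))" if X: "Good X" for X m
  proof -
    obtain i j :: nat where "X = b [^]\<^bsub>Sz2\<^esub> i \<otimes>\<^bsub>Sz2\<^esub> a [^]\<^bsub>Sz2\<^esub> j"
      using X[unfolded Good_def] by (elim exE)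
    then have "X \<otimes>\<^bsub>Sz2\<^esub> a [^]\<^bsub>Sz2\<^esub> m = b [^]\<^bsub>Sz2\<^esub> i \<otimes>\<^bsub>Sz2\<^esub> a [^]\<^bsub>Sz2\<^esub> (j + m)"
      using a b by (simp add: S.m_assoc S.nat_pow_mult)
    then show ?thesis unfolding Good_def by (intro exI)
  qed
  have Good_b1: "Good (X \<otimes>\<^bsub>Sz2\<^esub> b)" if X: "Good X" for X
  proof -
    obtain i j :: nat where "X = b [^]\<^bsub>Sz2\<^esub> i \<otimes>\<^bsub>Sz2\<^esub> a [^]\<^bsub>Sz2\<^esub> j"
      using X[unfolded Good_def] by (elim exE)
    then have "X \<otimes>\<^bsub>Sz2\<^esub> b = b [^]\<^bsub>Sz2\<^esub> Suc i \<otimes>\<^bsub>Sz2\<^esub> a [^]\<^bsub>Sz2\<^esub> (2 * j)"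
      using a b ab_pow[of j] by (simp add: S.m_assoc)
    then show ?thesis unfolding Good_def by (intro exI)
  qed
  have Good_b: "Good (X \<otimes>\<^bsub>Sz2\<^esub> b [^]\<^bsub>Sz2\<^esub> (m::nat))" if "Good X" "X \<in> carrier Sz2" for X m
    using that b by (induction m) (auto simp: Good_b1 simp flip: S.m_assoc)
  have "Good (?C w)" for w
  proof (induction w rule: rev_induct)
    case Nil
    have "?C [] = b [^]\<^bsub>Sz2\<^esub> (0::nat) \<otimes>\<^bsub>Sz2\<^esub> a [^]\<^bsub>Sz2\<^esub> (0::nat)" by (simp add: Sz2_one[symmetric])
    then show ?case unfolding Good_def by (intro exI)
  next
    case (snoc x w)
    have w: "?C w \<in> carrier Sz2" by (simp add: Sz2_carrier)
    obtain g s where x: "x = (g, s)" by fastforce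
    have "\<exists>m::nat. ?C [x] = a [^]\<^bsub>Sz2\<^esub> m \<or> ?C [x] = b [^]\<^bsub>Sz2\<^esub> m"
    proof (cases s)
      case True
      then have "?C [x] = a [^]\<^bsub>Sz2\<^esub> (1::nat) \<or> ?C [x] = b [^]\<^bsub>Sz2\<^esub> (1::nat)"
        using a b by (cases g) (auto simp: x a_def b_def)
      then show ?thesis by blast
    next
      case False
      have "?C [(Gen_a, False)] = a [^]\<^bsub>Sz2\<^esub> (4::nat)" "?C [(Gen_b, False)] = b [^]\<^bsub>Sz2\<^esub> (3::nat)"
        unfolding a_def b_def
        by (rule inv; use a5 b4 in \<open>simp add: a_def b_def eval_nat_numeral\<close>)+
      then show ?thesis using False x by (cases g) auto
    qed
    then show ?case
      using Good_a[OF snoc] Good_b[OF snoc w] unfolding Sz2_mult[symmetric] by metis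
  qed
  then obtain i j :: nat where X: "X = b [^]\<^bsub>Sz2\<^esub> i \<otimes>\<^bsub>Sz2\<^esub> a [^]\<^bsub>Sz2\<^esub> j"
    using assms(1) unfolding Sz2_carrier Good_def by blast
  have red: "x [^]\<^bsub>Sz2\<^esub> i = x [^]\<^bsub>Sz2\<^esub> (i mod m)"
    if "x \<in> carrier Sz2" "x [^]\<^bsub>Sz2\<^esub> m = \<one>\<^bsub>Sz2\<^esub>" for x and i m :: nat
  proof -
    have "x [^]\<^bsub>Sz2\<^esub> (m * (i div m)) = \<one>\<^bsub>Sz2\<^esub>"
      unfolding S.nat_pow_pow[OF that(1), symmetric] that(2) by simp
    moreover have "x [^]\<^bsub>Sz2\<^esub> (m * (i div m)) \<otimes>\<^bsub>Sz2\<^esub> x [^]\<^bsub>Sz2\<^esub> (i mod m)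
        = x [^]\<^bsub>Sz2\<^esub> (m * (i div m) + i mod m)"
      by (rule S.nat_pow_mult[OF that(1)])
    ultimately show ?thesis using that(1) by simp
  qed
  have "X = b [^]\<^bsub>Sz2\<^esub> (i mod 4) \<otimes>\<^bsub>Sz2\<^esub> a [^]\<^bsub>Sz2\<^esub> (j mod 5)"
    using X red[OF a a5, of j] red[OF b b4, of i] by simp
  moreover have "i mod 4 < 4" "j mod 5 < 5" by simp_all
  ultimately show ?thesis by blast
qed

text \<open>A surjection from a set of at most 20 elements onto one of exactly 20 is injective; no
  two normal forms need to be distinguished in the presented group.\<close>

lemma Sz2_iso_aff5: "Sz2 \<cong> aff5"
proof -
  let ?C = "word_class Sz2_relations"
  let ?f = "\<lambda>(i::nat, j::nat). ?C [(Gen_b, True)] [^]\<^bsub>Sz2\<^esub> i \<otimes>\<^bsub>Sz2\<^esub> ?C [(Gen_a, True)] [^]\<^bsub>Sz2\<^esub> j"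
  have sub: "carrier Sz2 \<subseteq> ?f ` ({..<4} \<times> {..<5})"
    using Sz2_normal_form by fastforce
  have fin: "finite (carrier Sz2)" by (rule finite_subset[OF sub]) simp
  have "card (carrier Sz2) \<le> card (?f ` ({..<4} \<times> {..<5}))"
    by (rule card_mono[OF _ sub]) simp
  also have "\<dots> \<le> card ({..<4::nat} \<times> {..<5::nat})" by (rule card_image_le) simp
  finally have le: "card (carrier Sz2) \<le> 20" by simp
  have "\<forall>p\<in>carrier aff5. p \<in> set (map (\<lambda>(i, j). aff5_word (replicate i (Gen_b, True) @
      replicate j (Gen_a, True))) (List.product [0..<4] [0..<5]))"
    unfolding aff5_carrier by code_simp
  then have "carrier aff5 \<subseteq> range aff5_word" by auto
  then have surj: "aff5_of_Sz2 ` carrier Sz2 = carrier aff5"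
    by (auto simp: Sz2_carrier aff5_of_Sz2_word_class aff5_word_closed image_image)
  have "card (carrier aff5) = 20" by (simp add: aff5_def)
  then have "inj_on aff5_of_Sz2 (carrier Sz2)"
    using le card_image_le[OF fin, of aff5_of_Sz2] by (intro eq_card_imp_inj_on fin) (simp add: surj)
  then have "aff5_of_Sz2 \<in> iso Sz2 aff5"
    using aff5_of_Sz2_hom surj by (simp add: iso_def bij_betw_def)
  then show ?thesis by (rule is_isoI)
qed

section \<open>The commuting graph\<close>

lemma (in group) center_subgroup: "subgroup (center G) G"
proof
  show "center G \<subseteq> carrier G" by (auto simp: center_def)
  show "\<one> \<in> center G" by (auto simp: center_def)
next
  fix x y assume "x \<in> center G" "y \<in> center G"
  then have xy: "x \<in> carrier G" "y \<in> carrier G"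
    and x: "\<And>g. g \<in> carrier G \<Longrightarrow> g \<otimes> x = x \<otimes> g"
    and y: "\<And>g. g \<in> carrier G \<Longrightarrow> g \<otimes> y = y \<otimes> g"
    by (auto simp: center_def)
  have "g \<otimes> (x \<otimes> y) = x \<otimes> y \<otimes> g" if g: "g \<in> carrier G" for g
  proof -
    have "g \<otimes> (x \<otimes> y) = x \<otimes> (g \<otimes> y)"
      using xy g x[OF g] by (simp flip: m_assoc)
    then show ?thesis using xy g y[OF g] by (simp add: m_assoc)
  qed
  then show "x \<otimes> y \<in> center G" using xy by (simp add: center_def)
next
  fix x assume "x \<in> center G"
  then have x: "x \<in> carrier G" "\<And>g. g \<in> carrier G \<Longrightarrow> g \<otimes> x = x \<otimes> g"
    by (auto simp: center_def)
  have "g \<otimes> inv x = inv x \<otimes> g" if g: "g \<in> carrier G" for g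
  proof -
    have "x \<otimes> (g \<otimes> inv x) = g \<otimes> x \<otimes> inv x"
      using x g by (simp flip: m_assoc)
    then have "g = x \<otimes> (g \<otimes> inv x)" using x(1) g by (simp add: m_assoc)
    then show ?thesis using x(1) g by (simp add: inv_solve_left)
  qed
  then show "inv x \<in> center G" using x by (simp add: center_def)
qed

lemma (in group) card_center_pos: "finite (carrier G) \<Longrightarrow> 0 < card (center G)"
  using subgroup.one_closed[OF center_subgroup] subgroup.subset[OF center_subgroup]
  by (metis card_gt_0_iff empty_iff finite_subset)

lemma (in group) center_normal: "center G \<lhd> G"
proof (rule normal_invI[OF center_subgroup])
  fix x z assume x: "x \<in> carrier G" and z: "z \<in> center G"
  then have "x \<otimes> z = z \<otimes> x" "z \<in> carrier G" by (auto simp: center_def)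
  with x z show "x \<otimes> z \<otimes> inv x \<in> center G" by (simp add: m_assoc)
qed

lemma (in group) center_carrier: "c \<in> center G \<Longrightarrow> c \<in> carrier G"
  by (simp add: center_def)

lemma (in group) center_commute: "c \<in> center G \<Longrightarrow> x \<in> carrier G \<Longrightarrow> c \<otimes> x = x \<otimes> c"
  by (simp add: center_def)

lemma (in group) center_mult_swap:
  assumes "c \<in> center G" "d \<in> center G" "x \<in> carrier G" "y \<in> carrier G"
  shows "c \<otimes> x \<otimes> (d \<otimes> y) = c \<otimes> d \<otimes> (x \<otimes> y)"
proof -
  have "c \<otimes> x \<otimes> (d \<otimes> y) = c \<otimes> (x \<otimes> d) \<otimes> y"
    using assms by (simp add: m_assoc center_carrier)
  also have "\<dots> = c \<otimes> d \<otimes> (x \<otimes> y)"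
    unfolding center_commute[OF assms(2,3), symmetric]
    using assms by (simp add: m_assoc center_carrier)
  finally show ?thesis .
qed

text \<open>The classes of \<open>aff5\<close> are pulled back along a surjection
  \<open>\<pi>\<close> from \<open>G\<close> with kernel \<open>center G\<close>. Its fibres are
  cosets of the center, so every class size is multiplied by \<open>card (center G)\<close>.\<close>

lemma (in group) clique_union_commuting_graph:
  assumes "finite (carrier G)" and "G Mod center G \<cong> Sz2"
  shows "\<exists>\<kappa>. clique_union (commuting_graph G) \<kappa> 6
    (\<lambda>j. if j = 5 then 4 * card (center G) else 3 * card (center G))"
proof -
  interpret Z: normal "center G" G by (rule center_normal)
  obtain \<psi> where \<psi>: "\<psi> \<in> iso (G Mod center G) aff5"
    using iso_trans[OF assms(2) Sz2_iso_aff5] by (auto simp: is_iso_def)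
  define \<pi> where "\<pi> x = \<psi> (center G #> x)" for x
  have "\<pi> \<in> hom G aff5"
    using Group.hom_compose[OF Z.r_coset_hom_Mod, of \<psi> aff5] \<psi>
    by (simp add: \<pi>_def[abs_def] comp_def iso_def)
  then have hom: "group_hom G aff5 \<pi>"
    by (simp add: group_hom_def group_hom_axioms_def is_group group_aff5)
  interpret \<pi>: group_hom G aff5 \<pi> by (rule hom)
  have inj: "inj_on \<psi> (rcosets (center G))" and img: "\<psi> ` (rcosets (center G)) = carrier aff5"
    using \<psi> by (auto simp: iso_def bij_betw_def FactGroup_def)
  have fibre: "{x \<in> carrier G. \<pi> x = p} \<in> rcosets (center G)" if p: "p \<in> carrier aff5" for p
  proof -
    obtain c where c: "c \<in> carrier G" "\<psi> (center G #> c) = p"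
      using p unfolding img[symmetric] by (auto simp: RCOSETS_def)
    have "{x \<in> carrier G. \<pi> x = p} = center G #> c"
    proof -
      have "\<pi> x = p \<longleftrightarrow> center G #> x = center G #> c" if "x \<in> carrier G" for x
        unfolding \<pi>_def c(2)[symmetric] using inj_on_eq_iff[OF inj] that c(1)
        by (simp add: rcosetsI Z.subset)
      moreover have "center G #> x = center G #> c \<longleftrightarrow> x \<in> center G #> c" if "x \<in> carrier G" for x
        using repr_independence[OF _ c(1) center_subgroup] rcos_self[OF that center_subgroup] by auto
      ultimately show ?thesis using r_coset_subset_G[OF Z.subset c(1)] by auto
    qed
    then show ?thesis using c(1) by (simp add: rcosetsI Z.subset)
  qed
  define z where "z = card (center G)"
  have card_fibre: "card {x \<in> carrier G. \<pi> x = p} = z" if "p \<in> carrier aff5" for p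
    using card_rcosets_equal[OF fibre[OF that] Z.subset] by (simp add: z_def)
  have one_iff: "\<pi> x = \<one>\<^bsub>aff5\<^esub> \<longleftrightarrow> x \<in> center G" if x: "x \<in> carrier G" for x
  proof -
    have "\<pi> x = \<pi> \<one> \<longleftrightarrow> center G #> x = center G #> \<one>"
      unfolding \<pi>_def
      by (rule inj_on_eq_iff[OF inj rcosetsI[OF Z.subset x] rcosetsI[OF Z.subset one_closed]])
    then show ?thesis
      using x coset_join1[OF _ x center_subgroup] coset_join2[OF x center_subgroup] Z.subset by auto
  qed
  define V where "V = carrier G - center G"
  have V: "x \<in> carrier G" "\<pi> x \<in> carrier aff5 - {\<one>\<^bsub>aff5\<^esub>}" if "x \<in> V" for x
    using that one_iff[of x] by (auto simp: V_def)
  have commute: "x \<otimes> y = y \<otimes> x \<longleftrightarrow> aff5_class (\<pi> x) = aff5_class (\<pi> y)"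
    if xV: "x \<in> V" and yV: "y \<in> V" for x y
  proof
    assume "x \<otimes> y = y \<otimes> x"
    then have "\<pi> x \<otimes>\<^bsub>aff5\<^esub> \<pi> y = \<pi> y \<otimes>\<^bsub>aff5\<^esub> \<pi> x"
      using V[OF xV] V[OF yV] by (metis \<pi>.hom_mult)
    then show "aff5_class (\<pi> x) = aff5_class (\<pi> y)"
      using aff5_commute_imp_class_eq V xV yV by blast
  next
    assume eq: "aff5_class (\<pi> x) = aff5_class (\<pi> y)"
    \<comment> \<open>A preimage \<open>g\<close> of the common root will generate both
      \<open>x\<close> and \<open>y\<close> up to central factors.\<close>
    have "aff5_root (aff5_class (\<pi> x)) \<in> \<pi> ` carrier G"
    proof -
      have "aff5_root (aff5_class (\<pi> x)) \<in> \<psi> ` (rcosets (center G))"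
        unfolding img by (rule aff5_root_closed)
      then show ?thesis by (auto simp: RCOSETS_def \<pi>_def)
    qed
    then obtain g where g: "g \<in> carrier G" "\<pi> g = aff5_root (aff5_class (\<pi> x))" by auto
    \<comment> \<open>In the quotient \<open>w\<close> is a power of the root; dividing by that
      power of \<open>g\<close> lands in the kernel of \<open>\<pi>\<close>, which is the
      center.\<close>
    have power: "\<exists>c\<in>center G. \<exists>k::nat. w = c \<otimes> g [^] k" if w: "w \<in> V" "aff5_class (\<pi> w) = aff5_class (\<pi> x)" for w
    proof -
      obtain k :: nat where "\<pi> w = \<pi> g [^]\<^bsub>aff5\<^esub> k"
        using aff5_power_of_root[OF V(2)[OF w(1)]] unfolding w(2) g(2) by blast
      also have "\<dots> = \<pi> (g [^] k)" using g(1) by (simp add: \<pi>.hom_nat_pow)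
      finally have "\<pi> (w \<otimes> inv (g [^] k)) = \<one>\<^bsub>aff5\<^esub>"
        using V(1)[OF w(1)] g(1) by simp
      then have "w \<otimes> inv (g [^] k) \<in> center G"
        using one_iff[of "w \<otimes> inv (g [^] k)"] V(1)[OF w(1)] g(1) by simp
      moreover have "w = w \<otimes> inv (g [^] k) \<otimes> g [^] k"
        using V(1)[OF w(1)] g(1) by (simp add: m_assoc)
      ultimately show ?thesis by blast
    qed
    obtain c and k :: nat where c: "c \<in> center G" and x: "x = c \<otimes> g [^] k"
      using power[OF xV HOL.refl] by blast
    obtain d and l :: nat where d: "d \<in> center G" and y: "y = d \<otimes> g [^] l"
      using power[OF yV eq[symmetric]] by blast
    have "x \<otimes> y = c \<otimes> d \<otimes> (g [^] k \<otimes> g [^] l)" "y \<otimes> x = d \<otimes> c \<otimes> (g [^] l \<otimes> g [^] k)"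
      unfolding x y using c d g(1) by (simp_all add: center_mult_swap)
    then show "x \<otimes> y = y \<otimes> x"
      using center_commute[OF c center_carrier[OF d]] g(1) by (simp add: nat_pow_mult add.commute)
  qed
  define N where "N j = (if j = 5 then 4 * z else 3 * z)" for j :: nat
  have "0 < z" using card_center_pos[OF assms(1)] by (simp add: z_def)
  have "clique_union (commuting_graph G) (\<lambda>x. aff5_class (\<pi> x)) 6 N"
  proof
    show "finite (vertices (commuting_graph G))" using assms(1) by (simp add: commuting_graph_def)
    show "aff5_class (\<pi> v) < 6" for v by (rule aff5_class_less)
    show "0 < N j" for j using \<open>0 < z\<close> by (simp add: N_def)
    show "edges (commuting_graph G) = {{x, y} |x y. x \<in> vertices (commuting_graph G) \<and>
        y \<in> vertices (commuting_graph G) \<and> x \<noteq> y \<and> aff5_class (\<pi> x) = aff5_class (\<pi> y)}"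
      using commute by (auto simp: commuting_graph_def V_def)
  next
    fix j :: nat assume j: "j < 6"
    let ?P = "{p \<in> carrier aff5 - {\<one>\<^bsub>aff5\<^esub>}. aff5_class p = j}"
    have fin: "finite ?P" by (simp add: aff5_carrier)
    \<comment> \<open>Fibres over nontrivial elements avoid the center, hence consist of
      vertices.\<close>
    have "{v \<in> vertices (commuting_graph G). aff5_class (\<pi> v) = j} = (\<Union>p\<in>?P. {x \<in> carrier G. \<pi> x = p})"
      using V one_iff[THEN iffD2, OF center_carrier] by (auto simp: commuting_graph_def V_def)
    also have "card \<dots> = (\<Sum>p\<in>?P. card {x \<in> carrier G. \<pi> x = p})"
      by (rule card_UN_disjoint[OF fin]) (use assms(1) in auto)
    also have "\<dots> = card ?P * z" by (simp add: card_fibre)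
    finally show "card {v \<in> vertices (commuting_graph G). aff5_class (\<pi> v) = j} = N j"
      unfolding card_aff5_class[OF j] by (simp add: N_def)
  qed
  then show ?thesis unfolding N_def z_def by blast
qed

section \<open>Evaluation of the three energies for the clique sizes at hand\<close>

theorem theorem2p1:
  fixes G :: "('a, 'b) monoid_scheme"
  assumes "group G"
    and "finite (carrier G)"
    and "G Mod center G \<cong> Sz2"
  shows "let z = real (card (center G)) in
      energy (commuting_graph G) = 38 * z - 12 \<and>
      laplacian_energy (commuting_graph G) =
        (if z \<le> 4 then (732 * z - 228) / 19
         else (120 * z\<^sup>2 + 122 * z - 38) / 19) \<and>
      signless_laplacian_energy (commuting_graph G) =
        (if z = 1 then (712 * z - 228) / 19
         else (120 * z\<^sup>2 + 530 * z - 190) / 19)"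
proof -
  interpret group G by fact
  define z where "z = card (center G)"
  define N where "N j = (if j = 5 then 4 * z else 3 * z)" for j :: nat
  have "0 < z" using card_center_pos[OF assms(2)] by (simp add: z_def)
  obtain \<kappa> where "clique_union (commuting_graph G) \<kappa> 6 N"
    using clique_union_commuting_graph[OF assms(2,3)] unfolding N_def[abs_def] z_def by blast
  then interpret clique_union "commuting_graph G" \<kappa> 6 N .
  have sum6: "(\<Sum>j<6. f j) = f 0 + f 1 + f 2 + f 3 + f 4 + f 5" for f :: "nat \<Rightarrow> real"
    by (simp add: eval_nat_numeral)
  define x where "x = real z"
  have x: "1 \<le> x" using \<open>0 < z\<close> by (simp add: x_def)
  \<comment> \<open>Integrality of \<open>z\<close> is used here: the signs below change at 19/4 and
    19/15, strictly between consecutive integers.\<close>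
  have x5: "x \<le> 4 \<or> 5 \<le> x" and x2: "x = 1 \<or> 2 \<le> x"
    using \<open>0 < z\<close> by (auto simp: x_def)
  have "real (card (vertices (commuting_graph G))) = (\<Sum>j<6. real (N j))"
    by (simp add: card_vertices)
  then have vertices: "real (card (vertices (commuting_graph G))) = 19 * x"
    unfolding sum6 by (simp add: N_def x_def)
  have "2 * real (card (edges (commuting_graph G))) = 61 * x\<^sup>2 - 19 * x"
    unfolding card_edges sum6 by (simp add: N_def x_def power2_eq_square algebra_simps)
  then have mean: "mean_degree = (61 * x - 19) / 19"
    using x by (simp add: vertices field_simps power2_eq_square)
  have E: "energy (commuting_graph G) = 38 * x - 12"
    unfolding energy_eq sum6 by (simp add: N_def x_def)
  have LE: "laplacian_energy (commuting_graph G) =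
      5 * ((3 * x - 1) * \<bar>3 * x - (61 * x - 19) / 19\<bar> + \<bar>(61 * x - 19) / 19\<bar>)
      + ((4 * x - 1) * \<bar>4 * x - (61 * x - 19) / 19\<bar> + \<bar>(61 * x - 19) / 19\<bar>)"
    unfolding laplacian_energy_eq mean sum6 by (simp add: N_def x_def)
  have SLE: "signless_laplacian_energy (commuting_graph G) =
      5 * ((3 * x - 1) * \<bar>3 * x - 2 - (61 * x - 19) / 19\<bar> + \<bar>2 * (3 * x) - 2 - (61 * x - 19) / 19\<bar>)
      + ((4 * x - 1) * \<bar>4 * x - 2 - (61 * x - 19) / 19\<bar> + \<bar>2 * (4 * x) - 2 - (61 * x - 19) / 19\<bar>)"
    unfolding signless_laplacian_energy_eq mean sum6 by (simp add: N_def x_def)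
  have "laplacian_energy (commuting_graph G) =
      (if x \<le> 4 then (732 * x - 228) / 19 else (120 * x\<^sup>2 + 122 * x - 38) / 19)"
  proof -
    \<comment> \<open>Only the difference for the cliques of size \<open>3 * x\<close> changes sign,
      which causes the case split at 4.\<close>
    have "\<bar>(61 * x - 19) / 19\<bar> = (61 * x - 19) / 19"
      and "\<bar>4 * x - (61 * x - 19) / 19\<bar> = (15 * x + 19) / 19"
      and "\<bar>3 * x - (61 * x - 19) / 19\<bar> = (if x \<le> 4 then (19 - 4 * x) / 19 else (4 * x - 19) / 19)"
      using x x5 by (auto simp: field_simps)
    then show ?thesis unfolding LE by (simp add: field_simps power2_eq_square)
  qed
  moreover have "signless_laplacian_energy (commuting_graph G) =
      (if x = 1 then (712 * x - 228) / 19 else (120 * x\<^sup>2 + 530 * x - 190) / 19)"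
  proof -
    \<comment> \<open>Only \<open>4 * x - 2\<close> minus the mean degree changes sign; it is
      negative exactly for \<open>x = 1\<close>.\<close>
    have "\<bar>2 * (4 * x) - 2 - (61 * x - 19) / 19\<bar> = (91 * x - 19) / 19"
      and "\<bar>2 * (3 * x) - 2 - (61 * x - 19) / 19\<bar> = (53 * x - 19) / 19"
      and "\<bar>3 * x - 2 - (61 * x - 19) / 19\<bar> = (4 * x + 19) / 19"
      and "\<bar>4 * x - 2 - (61 * x - 19) / 19\<bar> = (if x = 1 then (19 - 15 * x) / 19 else (15 * x - 19) / 19)"
      using x x2 by (auto simp: field_simps)
    then show ?thesis unfolding SLE by (simp add: field_simps power2_eq_square)
  qed
  ultimately show ?thesis using E by (simp add: Let_def x_def z_def)
qed

end
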